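(* There exists a polynomial-time algorithm that achieves a $0.5$-approximation for the sequential selection with expirations (SSE) problem, relative to the online optimum, when the evaluation times $S_1,\dots,S_n$ are independently and identically distributed; that is, on every SSE instance with i.i.d. evaluation times the algorithm implements an online policy whose expected total value is at least $\tfrac12\, v(\mathrm{OPT})$, where $v(\mathrm{OPT})$ is the maximum expected total value of an online policy for that instance.
   Context: SSE problem. An instance consists of $n$ options. Option $j\in[n]=\{1,\dots,n\}$ has a deterministic value $v_j>0$, a random evaluation time $S_j$ and a random expiration time $E_j$, both taking positive integer values; all these $2n$ random variables are mutually independent, with known distributions and initially unknown realizations. Write $\overline F_{S_j}(t)=\Pr(S_j>t)$ and $p_j(t)=\Pr(E_j>t)$. Standing assumptions: there is $T\in\mathbb N$ with $\overline F_{S_j}(T)=0$ for all $j$, and $p_j(t)>0$ for all $t\ge 1$ and all $j$. Time is discrete, $t=1,2,\dots$. Option $j$ is unexpired at time $t$ iff $E_j>t$; all options are available at time $1$ (so $p_j(1)=1$). A decision-maker (DM) evaluates one option at a time. The DM is free at time 1. If the DM is free at time $t$, it may select one option $j$ that is unexpired at time $t$ and has not been selected before; it is then busy for $S_j$ time units (free again at time $t+S_j$) and obtains value $v_j$. A selected option cannot be preempted and cannot expire. Meanwhile other options may expire. If the DM selects nothing at $t$, it is still free at $t+1$. An online policy decides, when the DM is free, which available option (if any) to select, using only the information revealed so far (past decisions, realized evaluation times of completed options, which options have expired), and possibly internal randomness. Its value is the expected sum of the values of the selected options; $\mathrm{OPT}$ denotes an optimal online policy. Polynomial time means that the running time is polynomial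 in $n$ and $T$. *)

theory Defs
  imports "HOL-Probability.Probability"
begin

section \<open>Instances\<close>

text \<open>The options are the elements of \<open>{1..num_opts I}\<close>; the components of an instance are irrelevant
  at other indices. Evaluation and expiration times are given by their laws, and mutual independence
  is built into \<open>outcome_law\<close>, the joint law of all realizations.\<close>

record sse =
  num_opts :: nat
  horizon :: nat
  worth :: "nat \<Rightarrow> real"
  eval_law :: "nat \<Rightarrow> nat pmf"
  expir_law :: "nat \<Rightarrow> nat pmf"

definition opts :: "sse \<Rightarrow> nat set" where
  "opts I = {1..num_opts I}"

definition eval_surv :: "sse \<Rightarrow> nat \<Rightarrow> nat \<Rightarrow> real" where
  "eval_surv I j t = measure_pmf.prob (eval_law I j) {t<..}"

definition expir_surv :: "sse \<Rightarrow> nat \<Rightarrow> nat \<Rightarrow> real" where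
  "expir_surv I j t = measure_pmf.prob (expir_law I j) {t<..}"

definition sse_instance :: "sse \<Rightarrow> bool" where
  "sse_instance I \<longleftrightarrow> (\<forall>j\<in>opts I.
     worth I j > 0 \<and>
     set_pmf (eval_law I j) \<subseteq> {1..} \<and>
     set_pmf (expir_law I j) \<subseteq> {1..} \<and>
     eval_surv I j (horizon I) = 0 \<and>
     expir_surv I j 1 = 1 \<and>
     (\<forall>t\<ge>1. expir_surv I j t > 0))"

definition iid_instances :: "sse set" where
  "iid_instances =
     {I. sse_instance I \<and> (\<forall>i\<in>opts I. \<forall>j\<in>opts I. eval_law I i = eval_law I j)}"

text \<open>An outcome is a pair \<open>(s, e)\<close> of realized evaluation and expiration times.\<close>

definition outcome_law :: "sse \<Rightarrow> ((nat \<Rightarrow> nat) \<times> (nat \<Rightarrow> nat)) pmf" where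
  "outcome_law I = pair_pmf (Pi_pmf (opts I) 0 (eval_law I)) (Pi_pmf (opts I) 0 (expir_law I))"


section \<open>Online policies\<close>

text \<open>The history before time \<open>t\<close> has one entry for each of the times \<open>1, \<dots>, t - 1\<close>: the set of
  options that were unexpired and not yet selected at that time, and what the decision-maker did.
  Since \<open>Busy\<close> entries are recorded, the history determines the realized evaluation times of the
  completed options. A (deterministic) policy is consulted only at times when the decision-maker is
  free; its second argument is the set of options available at the present time.\<close>

datatype event = Busy | Idle | Pick nat

type_synonym history = "(nat set \<times> event) list"

type_synonym policy = "history \<Rightarrow> nat set \<Rightarrow> nat option"

definition picked :: "history \<Rightarrow> nat set" where
  "picked h = {j. Pick j \<in> snd ` set h}"

definition available :: "sse \<Rightarrow> (nat \<Rightarrow> nat) \<Rightarrow> nat \<Rightarrow> nat set \<Rightarrow> nat set" where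
  "available I e t P = {j \<in> opts I. e j > t \<and> j \<notin> P}"

text \<open>\<open>trajectory I p s e t\<close> is the history covering the times \<open>1, \<dots>, t\<close>, together with the time from
  which on the decision-maker is free again.\<close>

primrec trajectory ::
  "sse \<Rightarrow> policy \<Rightarrow> (nat \<Rightarrow> nat) \<Rightarrow> (nat \<Rightarrow> nat) \<Rightarrow> nat \<Rightarrow> history \<times> nat" where
  "trajectory I p s e 0 = ([], 1)"
| "trajectory I p s e (Suc k) =
     (let (h, f) = trajectory I p s e k;
          t = Suc k;
          A = available I e t (picked h)
      in if t < f then (h @ [(A, Busy)], f)
         else (case p h A of
                 None \<Rightarrow> (h @ [(A, Idle)], f)
               | Some j \<Rightarrow> (h @ [(A, Pick j)], t + s j)))"

definition selections :: "sse \<Rightarrow> policy \<Rightarrow> (nat \<Rightarrow> nat) \<Rightarrow> (nat \<Rightarrow> nat) \<Rightarrow> (nat \<times> nat) set" where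
  "selections I p s e = {(t, j). t \<ge> 1 \<and> snd (last (fst (trajectory I p s e t))) = Pick j}"

definition total_worth :: "sse \<Rightarrow> policy \<Rightarrow> (nat \<Rightarrow> nat) \<Rightarrow> (nat \<Rightarrow> nat) \<Rightarrow> real" where
  "total_worth I p s e = (\<Sum>j\<in>snd ` selections I p s e. worth I j)"

text \<open>Internal randomness is an infinite sequence of independent uniform samples from the unit
  interval, independent of the outcome of the instance.\<close>

type_synonym seed = "nat \<Rightarrow> real"

definition seed_measure :: "seed measure" where
  "seed_measure = PiM UNIV (\<lambda>_. uniform_measure lborel {0..1})"

definition online_policy :: "(seed \<Rightarrow> policy) \<Rightarrow> bool" where
  "online_policy \<pi> \<longleftrightarrow>
     (\<forall>\<omega> h A j. \<pi> \<omega> h A = Some j \<longrightarrow> j \<in> A) \<and>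
     (\<forall>h A. (\<lambda>\<omega>. \<pi> \<omega> h A) \<in> measurable seed_measure (count_space UNIV))"

definition expected_worth :: "sse \<Rightarrow> (seed \<Rightarrow> policy) \<Rightarrow> real" where
  "expected_worth I \<pi> =
     (\<integral>\<omega>. measure_pmf.expectation (outcome_law I) (\<lambda>(s, e). total_worth I (\<pi> \<omega>) s e)
       \<partial>seed_measure)"

definition opt_worth :: "sse \<Rightarrow> real" where
  "opt_worth I = (SUP \<pi>\<in>{\<pi>. online_policy \<pi>}. expected_worth I \<pi>)"


section \<open>Algorithms\<close>

text \<open>The running time is to be polynomial in the number of options and the horizon alone, whatever
  the bit lengths of the numbers in the instance. Algorithms are therefore programs of a real RAM,
  in the form of a WHILE language that works on an unbounded array of natural numbers (for counters
  and addresses) and an unbounded array of reals, has unit-cost access to the data of the instance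
  and to random samples, and interacts with the process. There is no multiplication on addresses, no
  rounding of reals, and all literals are natural numbers, so neither unit-cost arithmetic nor
  program constants can encode additional computation.

  The only influence of the outcome \<open>(s, e)\<close> on a run is that \<open>Select\<close> advances the clock by the
  evaluation time of the selected option, and that the program can test whether an option is
  available at the present time. A program that ends selects nothing from then on.\<close>

datatype iexp =
    Lit nat
  | IMem iexp
  | Plus iexp iexp
  | Minus iexp iexp
  | NumOpts
  | Horizon
  | Clock

datatype rexp =
    OfNat iexp
  | RMem iexp
  | RPlus rexp rexp
  | RMinus rexp rexp
  | RTimes rexp rexp
  | RDivide rexp rexp
  | Worth iexp
  | EvalSurv iexp iexp
  | ExpirSurv iexp iexp

datatype test =
    ILess iexp iexp
  | RLess rexp rexp
  | IsAvailable iexp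
  | Neg test
  | Conj test test

datatype prog =
    Skip
  | IAssign iexp iexp
  | RAssign iexp rexp
  | Sample iexp
  | Select iexp
  | Wait
  | Seq prog prog
  | Branch test prog prog
  | While test prog

record state =
  imem :: "nat \<Rightarrow> nat"
  rmem :: "nat \<Rightarrow> real"
  clock :: nat
  samples :: nat
  sel_log :: "(nat \<times> nat) list"

definition init_state :: state where
  "init_state = \<lparr>imem = (\<lambda>_. 0), rmem = (\<lambda>_. 0), clock = 1, samples = 0, sel_log = []\<rparr>"

primrec ieval :: "sse \<Rightarrow> state \<Rightarrow> iexp \<Rightarrow> nat" where
  "ieval I \<sigma> (Lit c) = c"
| "ieval I \<sigma> (IMem a) = imem \<sigma> (ieval I \<sigma> a)"
| "ieval I \<sigma> (Plus a b) = ieval I \<sigma> a + ieval I \<sigma> b"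
| "ieval I \<sigma> (Minus a b) = ieval I \<sigma> a - ieval I \<sigma> b"
| "ieval I \<sigma> NumOpts = num_opts I"
| "ieval I \<sigma> Horizon = horizon I"
| "ieval I \<sigma> Clock = clock \<sigma>"

primrec reval :: "sse \<Rightarrow> state \<Rightarrow> rexp \<Rightarrow> real" where
  "reval I \<sigma> (OfNat a) = real (ieval I \<sigma> a)"
| "reval I \<sigma> (RMem a) = rmem \<sigma> (ieval I \<sigma> a)"
| "reval I \<sigma> (RPlus x y) = reval I \<sigma> x + reval I \<sigma> y"
| "reval I \<sigma> (RMinus x y) = reval I \<sigma> x - reval I \<sigma> y"
| "reval I \<sigma> (RTimes x y) = reval I \<sigma> x * reval I \<sigma> y"
| "reval I \<sigma> (RDivide x y) = reval I \<sigma> x / reval I \<sigma> y"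
| "reval I \<sigma> (Worth a) = worth I (ieval I \<sigma> a)"
| "reval I \<sigma> (EvalSurv a b) = eval_surv I (ieval I \<sigma> a) (ieval I \<sigma> b)"
| "reval I \<sigma> (ExpirSurv a b) = expir_surv I (ieval I \<sigma> a) (ieval I \<sigma> b)"

definition available_now :: "sse \<Rightarrow> (nat \<Rightarrow> nat) \<Rightarrow> state \<Rightarrow> nat set" where
  "available_now I e \<sigma> = available I e (clock \<sigma>) (snd ` set (sel_log \<sigma>))"

primrec holds :: "sse \<Rightarrow> (nat \<Rightarrow> nat) \<Rightarrow> state \<Rightarrow> test \<Rightarrow> bool" where
  "holds I e \<sigma> (ILess a b) \<longleftrightarrow> ieval I \<sigma> a < ieval I \<sigma> b"
| "holds I e \<sigma> (RLess x y) \<longleftrightarrow> reval I \<sigma> x < reval I \<sigma> y"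
| "holds I e \<sigma> (IsAvailable a) \<longleftrightarrow> ieval I \<sigma> a \<in> available_now I e \<sigma>"
| "holds I e \<sigma> (Neg b) \<longleftrightarrow> \<not> holds I e \<sigma> b"
| "holds I e \<sigma> (Conj b c) \<longleftrightarrow> holds I e \<sigma> b \<and> holds I e \<sigma> c"

text \<open>\<open>exec I \<omega> s e c \<sigma> k \<tau>\<close>: started in \<open>\<sigma>\<close>, the program \<open>c\<close> ends in \<open>\<tau>\<close> after \<open>k\<close> steps. A step is
  an elementary command or the evaluation of a test; the expressions in a program have a fixed size,
  so this is the number of elementary operations up to a constant factor. Selecting an option that
  is not available blocks the program.\<close>

inductive exec ::
  "sse \<Rightarrow> seed \<Rightarrow> (nat \<Rightarrow> nat) \<Rightarrow> (nat \<Rightarrow> nat) \<Rightarrow> prog \<Rightarrow> state \<Rightarrow> nat \<Rightarrow> state \<Rightarrow> bool"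
  for I \<omega> s e where
  Skip: "exec I \<omega> s e Skip \<sigma> 1 \<sigma>"
| IAssign: "exec I \<omega> s e (IAssign a b) \<sigma> 1 (\<sigma>\<lparr>imem := (imem \<sigma>)(ieval I \<sigma> a := ieval I \<sigma> b)\<rparr>)"
| RAssign: "exec I \<omega> s e (RAssign a x) \<sigma> 1 (\<sigma>\<lparr>rmem := (rmem \<sigma>)(ieval I \<sigma> a := reval I \<sigma> x)\<rparr>)"
| Sample: "exec I \<omega> s e (Sample a) \<sigma> 1
     (\<sigma>\<lparr>rmem := (rmem \<sigma>)(ieval I \<sigma> a := \<omega> (samples \<sigma>)), samples := Suc (samples \<sigma>)\<rparr>)"
| Select: "j = ieval I \<sigma> a \<Longrightarrow> j \<in> available_now I e \<sigma> \<Longrightarrow>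
     exec I \<omega> s e (Select a) \<sigma> 1 (\<sigma>\<lparr>clock := clock \<sigma> + s j, sel_log := sel_log \<sigma> @ [(clock \<sigma>, j)]\<rparr>)"
| Wait: "exec I \<omega> s e Wait \<sigma> 1 (\<sigma>\<lparr>clock := Suc (clock \<sigma>)\<rparr>)"
| Seq: "exec I \<omega> s e c \<sigma> k \<sigma>' \<Longrightarrow> exec I \<omega> s e d \<sigma>' l \<sigma>'' \<Longrightarrow>
     exec I \<omega> s e (Seq c d) \<sigma> (k + l) \<sigma>''"
| BranchTrue: "holds I e \<sigma> b \<Longrightarrow> exec I \<omega> s e c \<sigma> k \<sigma>' \<Longrightarrow>
     exec I \<omega> s e (Branch b c d) \<sigma> (Suc k) \<sigma>'"
| BranchFalse: "\<not> holds I e \<sigma> b \<Longrightarrow> exec I \<omega> s e d \<sigma> k \<sigma>' \<Longrightarrow>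
     exec I \<omega> s e (Branch b c d) \<sigma> (Suc k) \<sigma>'"
| WhileFalse: "\<not> holds I e \<sigma> b \<Longrightarrow> exec I \<omega> s e (While b c) \<sigma> 1 \<sigma>"
| WhileTrue: "holds I e \<sigma> b \<Longrightarrow> exec I \<omega> s e c \<sigma> k \<sigma>' \<Longrightarrow> exec I \<omega> s e (While b c) \<sigma>' l \<sigma>'' \<Longrightarrow>
     exec I \<omega> s e (While b c) \<sigma> (Suc (k + l)) \<sigma>''"

definition possible :: "sse \<Rightarrow> seed \<Rightarrow> (nat \<Rightarrow> nat) \<Rightarrow> (nat \<Rightarrow> nat) \<Rightarrow> bool" where
  "possible I \<omega> s e \<longleftrightarrow> (\<forall>i. \<omega> i \<in> {0..1}) \<and> (s, e) \<in> set_pmf (outcome_law I)"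

text \<open>The bound is on the length of the entire interaction with the process, for every seed and every
  outcome, with one polynomial for all instances.\<close>

definition polynomial_time :: "prog \<Rightarrow> sse set \<Rightarrow> bool" where
  "polynomial_time c \<I> \<longleftrightarrow> (\<exists>C d. \<forall>I\<in>\<I>. \<forall>\<omega> s e. possible I \<omega> s e \<longrightarrow>
     (\<exists>k \<tau>. exec I \<omega> s e c init_state k \<tau> \<and> k \<le> C * (num_opts I + horizon I + 1) ^ d))"

definition implements :: "sse \<Rightarrow> prog \<Rightarrow> (seed \<Rightarrow> policy) \<Rightarrow> bool" where
  "implements I c \<pi> \<longleftrightarrow> (\<forall>\<omega> s e. possible I \<omega> s e \<longrightarrow>
     (\<exists>k \<tau>. exec I \<omega> s e c init_state k \<tau> \<and> set (sel_log \<tau>) = selections I (\<pi> \<omega>) s e))"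

end

theory Submission
  imports Defs
begin

text \<open>Greedily selecting the most valuable available option is already a 1/2-approximation. Since the
  evaluation times are i.i.d., two policies can be coupled so that their \<open>m\<close>-th selections take equally
  long, for every \<open>m\<close>; greedy then makes its \<open>m\<close>-th selection no later than any other policy. For a
  fixed coupled outcome, charge each selection of the other policy to the same option if greedy
  selects it too, and otherwise to the greedy selection of the same rank, at which the option was
  still available to greedy. Every greedy selection is charged at most twice.\<close>

section \<open>Selections in chronological order\<close>

fun pick_entry :: "nat \<Rightarrow> event \<Rightarrow> (nat \<times> nat) list" where
  "pick_entry t (Pick j) = [(t, j)]"
| "pick_entry t _ = []"

text \<open>\<open>selections\<close> is a set and forgets the order. The coupling and the charging
  both refer to the rank of a selection, so the selections are kept as a list.\<close>

primrec selection_list ::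
  "sse \<Rightarrow> policy \<Rightarrow> (nat \<Rightarrow> nat) \<Rightarrow> (nat \<Rightarrow> nat) \<Rightarrow> nat \<Rightarrow> (nat \<times> nat) list" where
  "selection_list I p s e 0 = []"
| "selection_list I p s e (Suc k) = selection_list I p s e k @
     pick_entry (Suc k) (snd (last (fst (trajectory I p s e (Suc k)))))"

definition free_time :: "sse \<Rightarrow> policy \<Rightarrow> (nat \<Rightarrow> nat) \<Rightarrow> (nat \<Rightarrow> nat) \<Rightarrow> nat \<Rightarrow> nat" where
  "free_time I p s e k = snd (trajectory I p s e k)"

definition picks :: "sse \<Rightarrow> policy \<Rightarrow> (nat \<Rightarrow> nat) \<Rightarrow> (nat \<Rightarrow> nat) \<Rightarrow> nat \<Rightarrow> nat list" where
  "picks I p s e k = map snd (selection_list I p s e k)"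

lemma picked_snoc:
  "picked (h @ [(A, Pick j)]) = insert j (picked h)"
  "picked (h @ [(A, Busy)]) = picked h"
  "picked (h @ [(A, Idle)]) = picked h"
  by (auto simp: picked_def)

lemma picked_trajectory: "picked (fst (trajectory I p s e k)) = set (picks I p s e k)"
proof (induction k)
  case 0
  then show ?case by (simp add: picks_def picked_def)
next
  case (Suc k)
  obtain h f where tr: "trajectory I p s e k = (h, f)" by force
  with Suc show ?case
    by (auto simp: picks_def picked_snoc Let_def split: option.splits)
qed

text \<open>Serves as the case rule of the inductions on time: it describes one step through
  \<open>selection_list\<close> and \<open>free_time\<close>, and the history survives only as an
  argument of the policy.\<close>

lemma trajectory_cases [consumes 0, case_names busy idle pick]:
  fixes I p s e k
  defines "h \<equiv> fst (trajectory I p s e k)"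
  defines "A \<equiv> available I e (Suc k) (set (picks I p s e k))"
  obtains
    "Suc k < free_time I p s e k"
    "selection_list I p s e (Suc k) = selection_list I p s e k"
    "free_time I p s e (Suc k) = free_time I p s e k"
  | "free_time I p s e k \<le> Suc k" "p h A = None"
    "selection_list I p s e (Suc k) = selection_list I p s e k"
    "free_time I p s e (Suc k) = free_time I p s e k"
  | j where "free_time I p s e k \<le> Suc k" "p h A = Some j"
    "selection_list I p s e (Suc k) = selection_list I p s e k @ [(Suc k, j)]"
    "free_time I p s e (Suc k) = Suc k + s j"
proof -
  obtain h' f where tr: "trajectory I p s e k = (h', f)" by force
  have h: "h = h'" and f: "free_time I p s e k = f"
    by (simp_all add: h_def free_time_def tr)
  have A: "A = available I e (Suc k) (picked h')"
    using picked_trajectory[of I p s e k] by (simp add: A_def tr)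
  show thesis
  proof (cases "Suc k < f")
    case True
    then show thesis using that(1) by (simp add: f free_time_def tr)
  next
    case False
    show thesis
    proof (cases "p h A")
      case None
      then show thesis using that(2) False f by (simp add: free_time_def tr h A)
    next
      case (Some j)
      then show thesis using that(3) False f by (simp add: free_time_def tr h A)
    qed
  qed
qed

lemma selections_eq: "selections I p s e = (\<Union>k. set (selection_list I p s e k))"
proof -
  have "(t, j) \<in> set (selection_list I p s e k) \<longleftrightarrow> t \<in> {1..k} \<and> snd (last (fst (trajectory I p s e t))) = Pick j"
    for t j k
  proof (induction k)
    case (Suc k)
    have "(t, j) \<in> set (pick_entry (Suc k) ev) \<longleftrightarrow> t = Suc k \<and> ev = Pick j" for ev
      by (cases ev) auto
    with Suc show ?case by (auto simp: le_Suc_eq simp del: trajectory.simps)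
  qed simp
  then show ?thesis
    by (fastforce simp: selections_def simp del: trajectory.simps)
qed

lemma selection_list_mono:
  "k \<le> l \<Longrightarrow> \<exists>ys. selection_list I p s e l = selection_list I p s e k @ ys"
  by (induction l rule: dec_induct) (auto simp del: trajectory.simps)

text \<open>What \<open>online_policy\<close> demands of \<open>\<pi> \<omega>\<close> for a fixed
  seed \<open>\<omega>\<close>, so that a randomized policy can be treated one seed at a
  time.\<close>

definition valid_policy :: "policy \<Rightarrow> bool" where
  "valid_policy p \<longleftrightarrow> (\<forall>h A j. p h A = Some j \<longrightarrow> j \<in> A)"

lemma finite_opts [simp]: "finite (opts I)"
  by (simp add: opts_def)

lemma distinct_picks:
  assumes "valid_policy p"
  shows "distinct (picks I p s e k) \<and> set (picks I p s e k) \<subseteq> opts I"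
proof (induction k)
  case 0
  then show ?case by (simp add: picks_def)
next
  case (Suc k)
  show ?case
    using Suc assms
    by (cases rule: trajectory_cases[of k I p s e])
       (auto simp: picks_def valid_policy_def available_def simp del: selection_list.simps dest!: spec)
qed

lemma selection_before_expiry:
  assumes "valid_policy p" "(t, j) \<in> set (selection_list I p s e k)"
  shows "t < e j"
  using assms(2)
proof (induction k)
  case (Suc k)
  then show ?case using assms(1)
    by (cases rule: trajectory_cases[of k I p s e])
       (force simp: valid_policy_def available_def simp del: selection_list.simps dest!: spec)+
qed simp

text \<open>From time \<open>Suc K\<close> on every option has been selected or has expired, so the
  available set stays empty. This reduces the infinite union behind \<open>selections\<close> to a
  finite prefix.\<close>

lemma selections_stable:
  assumes "valid_policy p"
    and "\<And>j. j \<in> opts I \<Longrightarrow> j \<notin> set (picks I p s e K) \<Longrightarrow> e j \<le> Suc K"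
  shows "selections I p s e = set (selection_list I p s e K)"
proof -
  have *: "selection_list I p s e k = selection_list I p s e K" if "K \<le> k" for k
    using that
  proof (induction k rule: dec_induct)
    case (step k)
    have "available I e (Suc k) (set (picks I p s e k)) = {}"
      using assms(2) step by (fastforce simp: available_def picks_def)
    then show ?case using assms(1) step
      by (cases rule: trajectory_cases[of k I p s e])
         (auto simp: valid_policy_def simp del: selection_list.simps)
  qed simp
  have "set (selection_list I p s e k) \<subseteq> set (selection_list I p s e K)" for k
    using *[of k] selection_list_mono[of k K I p s e] by (cases "K \<le> k") auto
  then show ?thesis by (auto simp: selections_eq)
qed

text \<open>Before a selection, all earlier selections must have been completed, one after the other
  from time 1; idling only adds delay. The bound on \<open>free_time\<close> is what carries the
  induction.\<close>

lemma start_time_ge: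
  shows "1 + sum_list (map s (picks I p s e k)) \<le> free_time I p s e k"
    and "m < length (selection_list I p s e k) \<Longrightarrow>
      1 + sum_list (map s (take m (picks I p s e k))) \<le> fst (selection_list I p s e k ! m)"
proof -
  have "1 + sum_list (map s (picks I p s e k)) \<le> free_time I p s e k \<and>
    (\<forall>m<length (selection_list I p s e k).
      1 + sum_list (map s (take m (picks I p s e k))) \<le> fst (selection_list I p s e k ! m))"
  proof (induction k)
    case 0
    then show ?case by (simp add: picks_def free_time_def)
  next
    case (Suc k)
    show ?case
    proof (cases rule: trajectory_cases[of k I p s e])
      case (pick j)
      have "1 + sum_list (map s (picks I p s e k)) \<le> Suc k"
        using Suc pick by linarith
      with Suc pick show ?thesis
        by (auto simp: picks_def nth_append less_Suc_eq simp del: selection_list.simps)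
    qed (use Suc in \<open>simp_all add: picks_def del: selection_list.simps\<close>)
  qed
  then show "1 + sum_list (map s (picks I p s e k)) \<le> free_time I p s e k"
    and "m < length (selection_list I p s e k) \<Longrightarrow>
      1 + sum_list (map s (take m (picks I p s e k))) \<le> fst (selection_list I p s e k ! m)"
    by auto
qed


section \<open>The greedy policy\<close>

text \<open>Has the shape of the loop that the program runs, so that one function both defines the
  policy and specifies the program. Options are numbered from 1, which leaves 0 free to mean that
  there is no candidate. Ties go to the smaller index.\<close>

primrec scan :: "sse \<Rightarrow> nat set \<Rightarrow> nat \<Rightarrow> nat \<Rightarrow> nat" where
  "scan I A b 0 = b"
| "scan I A b (Suc i) =
     scan I A (if Suc i \<in> A \<and> \<not> (0 < b \<and> worth I (Suc i) < worth I b) then Suc i else b) i"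

lemma scan_mem: "scan I A b i \<in> insert b A"
proof (induction i arbitrary: b)
  case (Suc i)
  show ?case
    using Suc[of b] Suc[of "Suc i"] by auto
qed simp

text \<open>A candidate is replaced only by an option of at least equal worth. The second disjunct
  lets the induction carry the current candidate along with the options still to be scanned.\<close>

lemma scan_best:
  assumes "j \<in> A \<inter> {1..i} \<or> j = b \<and> 0 < b"
  shows "0 < scan I A b i \<and> worth I j \<le> worth I (scan I A b i)"
  using assms
proof (induction i arbitrary: b j)
  case (Suc i)
  show ?case
  proof (cases "Suc i \<in> A \<and> \<not> (0 < b \<and> worth I (Suc i) < worth I b)")
    case True
    then have "worth I j \<le> worth I (Suc i)" if "j = b" "0 < b" using that by auto
    with True Suc.IH[of j "Suc i"] Suc.IH[of "Suc i" "Suc i"] Suc.prems show ?thesis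
      by (auto simp: le_Suc_eq)
  next
    case False
    then have "0 < b \<and> worth I j \<le> worth I b" if "j = Suc i" "j \<in> A" using that by auto
    with False Suc.IH[of j b] Suc.IH[of b b] Suc.prems show ?thesis
      by (auto simp: le_Suc_eq split del: if_split)
  qed
qed auto

definition greedy :: "sse \<Rightarrow> policy" where
  "greedy I h A = (let b = scan I A 0 (num_opts I) in if b = 0 then None else Some b)"

lemma valid_greedy: "valid_policy (greedy I)"
proof -
  have "scan I A 0 (num_opts I) \<in> A" if "scan I A 0 (num_opts I) \<noteq> 0" for A
    using scan_mem[of I A 0 "num_opts I"] that by simp
  then show ?thesis
    by (simp add: valid_policy_def greedy_def Let_def)
qed

lemma greedy_None: "greedy I h A = None \<Longrightarrow> j \<in> opts I \<Longrightarrow> j \<notin> A"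
  using scan_best[of j A "num_opts I" 0 I]
  by (auto simp: greedy_def Let_def opts_def split: if_splits)

lemma greedy_Some: "greedy I h A = Some i \<Longrightarrow> j \<in> A \<Longrightarrow> j \<in> opts I \<Longrightarrow> worth I j \<le> worth I i"
  using scan_best[of j A "num_opts I" 0 I]
  by (auto simp: greedy_def Let_def opts_def split: if_splits)

text \<open>The available set only shrinks while nothing is selected, so greedy never selects again
  once it has idled. Its start times are therefore exact sums of evaluation times, where other
  policies have only a lower bound. The premise \<open>f k \<le> k\<close> says that greedy was
  already free at time \<open>f k\<close> and found nothing.\<close>

lemma greedy_invariant:
  fixes e :: "nat \<Rightarrow> nat"
  assumes s: "\<And>j. j \<in> opts I \<Longrightarrow> 1 \<le> s j"
  defines "L \<equiv> picks I (greedy I) s e" and "f \<equiv> free_time I (greedy I) s e"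
  shows "f k = 1 + sum_list (map s (L k))"
    and "f k \<le> k \<Longrightarrow> j \<in> opts I \<Longrightarrow> j \<notin> set (L k) \<Longrightarrow> e j \<le> f k"
    and "m < length (L k) \<Longrightarrow> j \<in> opts I \<Longrightarrow> 1 + sum_list (map s (take m (L k))) < e j \<Longrightarrow>
      j \<notin> set (take m (L k)) \<Longrightarrow> worth I j \<le> worth I (L k ! m)"
proof -
  have "f k = 1 + sum_list (map s (L k)) \<and>
    (f k \<le> k \<longrightarrow> (\<forall>j\<in>opts I. j \<notin> set (L k) \<longrightarrow> e j \<le> f k)) \<and>
    (\<forall>m<length (L k). \<forall>j\<in>opts I. 1 + sum_list (map s (take m (L k))) < e j \<longrightarrow>
      j \<notin> set (take m (L k)) \<longrightarrow> worth I j \<le> worth I (L k ! m))"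
  proof (induction k)
    case 0
    then show ?case by (simp add: L_def f_def picks_def free_time_def)
  next
    case (Suc k)
    show ?case
    proof (cases rule: trajectory_cases[of k I "greedy I" s e])
      case busy
      then have "L (Suc k) = L k" "f (Suc k) = f k" "Suc k < f k"
        by (auto simp: L_def f_def picks_def simp del: selection_list.simps)
      with Suc show ?thesis by auto
    next
      case idle
      then have *: "L (Suc k) = L k" "f (Suc k) = f k"
        by (auto simp: L_def f_def picks_def simp del: selection_list.simps)
      have "e j \<le> Suc k" if "j \<in> opts I" "j \<notin> set (L k)" for j
        using greedy_None[OF idle(2) that(1)] that by (simp add: available_def L_def)
      moreover have "f k \<le> k \<or> f k = Suc k" using idle(1) by (auto simp: f_def)
      ultimately show ?thesis using Suc * by auto
    next
      case (pick i)
      let ?A = "available I e (Suc k) (set (L k))"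
      have *: "L (Suc k) = L k @ [i]" "f (Suc k) = Suc k + s i"
        using pick by (auto simp: L_def f_def picks_def simp del: selection_list.simps)
      have i: "i \<in> ?A"
        using pick(2) valid_greedy by (auto simp: valid_policy_def L_def)
      then have "1 \<le> s i" using s by (simp add: available_def)
      \<comment> \<open>Greedy selects at the very moment it becomes free: had it been free earlier,
        the second invariant would leave no unselected option unexpired.\<close>
      have f: "f k = Suc k"
      proof (rule ccontr)
        assume "f k \<noteq> Suc k"
        then have "f k \<le> k" using pick(1) by (simp add: f_def)
        with Suc i show False by (auto simp: available_def)
      qed
      have "worth I j \<le> worth I i" if "j \<in> opts I" "Suc k < e j" "j \<notin> set (L k)" for j
        using greedy_Some[OF pick(2) _ that(1)] that by (simp add: available_def L_def)
      with Suc f show ?thesis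
        using \<open>1 \<le> s i\<close> by (auto simp: * nth_append less_Suc_eq)
    qed
  qed
  then show "f k = 1 + sum_list (map s (L k))"
    and "f k \<le> k \<Longrightarrow> j \<in> opts I \<Longrightarrow> j \<notin> set (L k) \<Longrightarrow> e j \<le> f k"
    and "m < length (L k) \<Longrightarrow> j \<in> opts I \<Longrightarrow> 1 + sum_list (map s (take m (L k))) < e j \<Longrightarrow>
      j \<notin> set (take m (L k)) \<Longrightarrow> worth I j \<le> worth I (L k ! m)"
    by auto
qed


section \<open>Coupling by order of selection\<close>

text \<open>A cutoff that depends on \<open>e\<close> alone, so that coupled runs, which share
  \<open>e\<close>, are cut at the same time. The sum bounds the maximum and is also defined when
  there are no options.\<close>

definition last_expiry :: "sse \<Rightarrow> (nat \<Rightarrow> nat) \<Rightarrow> nat" where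
  "last_expiry I e = sum e (opts I)"

text \<open>Listing the evaluation times in the order of selection, followed by those of the unselected
  options, is a weight-preserving bijection on i.i.d. outcomes for every policy. This gives the
  coupling.\<close>

definition ordering :: "sse \<Rightarrow> policy \<Rightarrow> (nat \<Rightarrow> nat) \<Rightarrow> (nat \<Rightarrow> nat) \<Rightarrow> nat list" where
  "ordering I p s e = (let xs = picks I p s e (last_expiry I e)
     in xs @ sorted_list_of_set (opts I - set xs))"

section \<open>Charging and decoding along the order of selection\<close>

lemma expiry_le_last: "j \<in> opts I \<Longrightarrow> e j \<le> last_expiry I e"
  by (simp add: last_expiry_def member_le_sum)

lemma total_worth_eq:
  assumes "valid_policy p"
  shows "total_worth I p s e = sum (worth I) (set (picks I p s e (last_expiry I e)))"
  using selections_stable[OF assms le_SucI[OF expiry_le_last[of _ I e]]]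
  by (simp add: total_worth_def picks_def)

lemma distinct_ordering:
  assumes "valid_policy p"
  shows "distinct (ordering I p s e)" "set (ordering I p s e) = opts I"
  using distinct_picks[OF assms, of I s e "last_expiry I e"]
  by (auto simp: ordering_def Let_def)

text \<open>The hypothesis \<open>eq\<close> is the coupling: evaluation times agree rank by rank,
  although they may belong to different options, and the expiration times \<open>e\<close> are
  shared.\<close>

lemma greedy_half_pathwise:
  assumes p: "valid_policy p"
    and pos: "\<And>j. j \<in> opts I \<Longrightarrow> 0 < worth I j"
    and s': "\<And>j. j \<in> opts I \<Longrightarrow> 1 \<le> s' j"
    and eq: "map s (ordering I p s e) = map s' (ordering I (greedy I) s' e)"
  shows "total_worth I p s e \<le> 2 * total_worth I (greedy I) s' e"
proof -
  define K where "K = last_expiry I e"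
  define P where "P = picks I p s e K"
  define L where "L = selection_list I p s e K"
  define G where "G = picks I (greedy I) s' e K"
  have len: "length P = length L" by (simp add: P_def L_def picks_def)
  have P: "distinct P" "set P \<subseteq> opts I" and G: "distinct G" "set G \<subseteq> opts I"
    using distinct_picks[OF p, of I s e K] distinct_picks[OF valid_greedy[of I], of I s' e K]
    by (auto simp: P_def G_def)
  \<comment> \<open>Restricted to ranks at which both policies select; further on,
    \<open>ordering\<close> continues with unselected options.\<close>
  have take_eq: "map s (take m P) = map s' (take m G)" if "m \<le> length P" "m \<le> length G" for m
  proof -
    have "take m (map s (ordering I p s e)) = map s (take m P)"
      "take m (map s' (ordering I (greedy I) s' e)) = map s' (take m G)"
      using that by (simp_all add: ordering_def Let_def take_map P_def G_def K_def)
    with eq show ?thesis by simp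
  qed
  have charge: "m < length G \<and> worth I (P ! m) \<le> worth I (G ! m)"
    if m: "m < length P" "P ! m \<notin> set G" for m
  proof -
    define j where "j = P ! m"
    have j: "j \<in> opts I" using P m by (auto simp: j_def)
    have Lm: "L ! m \<in> set L" "snd (L ! m) = j"
      using m len by (auto simp: j_def P_def L_def picks_def)
    then have te: "fst (L ! m) < e j"
      using selection_before_expiry[OF p, of "fst (L ! m)" j I s e K]
      by (metis L_def prod.collapse)
    have start: "1 + sum_list (map s (take m P)) \<le> fst (L ! m)"
      using start_time_ge(2)[of m I p s e K] m len by (simp add: P_def L_def)
    \<comment> \<open>With at most \<open>m\<close> selections, greedy would be free no later than
      \<open>p\<close> starts \<open>j\<close>, hence before \<open>e j \<le> K\<close>. But then
      the second invariant says that the unselected option \<open>j\<close> has expired by that free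
      time.\<close>
    have "m < length G"
    proof (rule ccontr)
      assume "\<not> m < length G"
      then have l: "length G \<le> m" by simp
      have "free_time I (greedy I) s' e K = 1 + sum_list (map s' G)"
        using greedy_invariant(1)[of I s' e K] s' by (simp add: G_def)
      also have "map s' G = map s (take (length G) P)"
        using take_eq[of "length G"] l m by simp
      also have "sum_list (map s (take m P)) =
          sum_list (map s (take (length G) P)) + sum_list (map s (take (m - length G) (drop (length G) P)))"
        using l by (metis le_add_diff_inverse map_append sum_list_append take_add)
      then have "1 + sum_list (map s (take (length G) P)) \<le> 1 + sum_list (map s (take m P))"
        by simp
      finally have f: "free_time I (greedy I) s' e K < e j" using start te by linarith
      moreover have "e j \<le> K" using expiry_le_last[OF j] by (simp add: K_def)
      ultimately have "e j \<le> free_time I (greedy I) s' e K"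
        using greedy_invariant(2)[of I s' e K j] s' j m(2) by (simp add: G_def j_def)
      with f show False by simp
    qed
    moreover have "worth I j \<le> worth I (G ! m)"
    proof -
      \<comment> \<open>Equal evaluation times at the first \<open>m\<close> ranks put greedy's
        selection of rank \<open>m\<close> no later than that of \<open>p\<close>, at which
        \<open>j\<close> is unexpired.\<close>
      have "1 + sum_list (map s' (take m G)) < e j"
        using start te take_eq[of m] m \<open>m < length G\<close> by simp
      moreover have "j \<notin> set (take m G)"
        using m(2) by (auto simp: j_def dest: in_set_takeD)
      ultimately show ?thesis
        using greedy_invariant(3)[of I s' m e K j] s' j \<open>m < length G\<close> by (simp add: G_def)
    qed
    ultimately show ?thesis by (simp add: j_def)
  qed
  \<comment> \<open>The ranks at which \<open>p\<close> takes an option that greedy never takes.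
    Distinct ranks charge distinct greedy selections, so these charges cost at most one greedy
    total; the options common to both policies cost at most another.\<close>
  define M where "M = {m. m < length P \<and> P ! m \<notin> set G}"
  have M: "finite M" "M \<subseteq> {..<length G}" "inj_on ((!) P) M" "set P - set G = (!) P ` M"
    using charge P(1) by (auto simp: M_def inj_on_def nth_eq_iff_index_eq in_set_conv_nth)
  have pos_nth: "0 \<le> worth I (G ! m)" if "m < length G" for m
    using pos[of "G ! m"] G that by (auto intro: less_imp_le dest: nth_mem)
  have "sum (worth I) (set P) = sum (worth I) (set P \<inter> set G) + sum (worth I) (set P - set G)"
    by (simp add: sum.Int_Diff)
  also have "sum (worth I) (set P \<inter> set G) \<le> sum (worth I) (set G)"
    using G pos by (intro sum_mono2) (auto intro: less_imp_le)
  also have "sum (worth I) (set P - set G) = (\<Sum>m\<in>M. worth I (P ! m))"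
    using M by (simp add: sum.reindex)
  also have "\<dots> \<le> (\<Sum>m\<in>M. worth I (G ! m))"
    using charge by (intro sum_mono) (auto simp: M_def)
  also have "\<dots> \<le> (\<Sum>m<length G. worth I (G ! m))"
    using M pos_nth by (intro sum_mono2) auto
  also have "\<dots> = sum (worth I) (set G)"
    using G by (simp add: sum.distinct_set_conv_list sum_list_sum_nth atLeast0LessThan)
  finally show ?thesis
    by (simp add: total_worth_eq[OF p] total_worth_eq[OF valid_greedy] P_def G_def K_def)
qed

text \<open>The list can be decoded from the front: the run so far determines the next option to be
  selected, and the next entry is its evaluation time. Equal lists thus force equal runs, hence
  equal orders, and then \<open>s\<close> and \<open>s'\<close> agree option by option.\<close>

lemma ordering_reveals_outcome:
  assumes p: "valid_policy p"
    and eq: "map s (ordering I p s e) = map s' (ordering I p s' e)"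
    and out: "\<And>j. j \<notin> opts I \<Longrightarrow> s j = s' j"
  shows "s = s'"
proof -
  define K where "K = last_expiry I e"
  have same: "k \<le> K \<Longrightarrow> trajectory I p s e k = trajectory I p s' e k \<and>
      selection_list I p s e k = selection_list I p s' e k" for k
  proof (induction k)
    case (Suc k)
    obtain h f where tr: "trajectory I p s e k = (h, f)" by force
    with Suc have tr': "trajectory I p s' e k = (h, f)" by simp
    have sl: "selection_list I p s e k = selection_list I p s' e k"
      using Suc by simp
    show ?case
    proof (cases rule: trajectory_cases[of k I p s e])
      case (pick j)
      then have sel: "f \<le> Suc k" "p h (available I e (Suc k) (picked h)) = Some j"
        using picked_trajectory[of I p s e k] by (auto simp: tr free_time_def)
      \<comment> \<open>The new selection has rank \<open>m\<close> in both runs. Later selections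
        are only appended, so it sits at position \<open>m\<close> of both orderings before anything
        is known about their tails.\<close>
      define m where "m = length (selection_list I p s e k)"
      have nth: "ordering I p q e ! m = j" "m < length (ordering I p q e)"
        if "trajectory I p q e k = (h, f)" "length (selection_list I p q e k) = m" for q
      proof -
        have "selection_list I p q e (Suc k) = selection_list I p q e k @ [(Suc k, j)]"
          using sel by (simp add: that(1) Let_def)
        then obtain ys where "selection_list I p q e K = selection_list I p q e k @ (Suc k, j) # ys"
          using selection_list_mono[OF Suc.prems, of I p q e] by auto
        then show "ordering I p q e ! m = j" "m < length (ordering I p q e)"
          using that(2) by (auto simp: ordering_def Let_def picks_def K_def nth_append)
      qed
      have "map s (ordering I p s e) ! m = map s' (ordering I p s' e) ! m"
        using eq by simp
      then have "s j = s' j"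
        using nth[OF tr] nth[OF tr'] sl by (simp add: m_def)
      then show ?thesis
        using sl sel by (simp add: tr tr' Let_def)
    qed (use sl tr tr' picked_trajectory[of I p s e k] in \<open>auto simp: free_time_def Let_def\<close>)
  qed simp
  then have "ordering I p s e = ordering I p s' e"
    by (simp add: ordering_def picks_def K_def)
  with eq have "\<forall>j\<in>set (ordering I p s e). s j = s' j" by simp
  with out show ?thesis
    using distinct_ordering(2)[OF p] by (metis ext)
qed

text \<open>Discrete change of variables. The support may be infinite, as it is for the outcome law
  of an instance with at least one option, where expiration times are unbounded.\<close>

lemma map_pmf_bij_invariant:
  assumes bij: "bij_betw f (set_pmf M) (set_pmf M)"
    and inv: "\<And>x. x \<in> set_pmf M \<Longrightarrow> pmf M (f x) = pmf M x"
  shows "map_pmf f M = M"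
proof (rule pmf_eqI)
  fix y
  show "pmf (map_pmf f M) y = pmf M y"
  proof (cases "y \<in> set_pmf M")
    case True
    then obtain x where "x \<in> set_pmf M" "y = f x"
      using bij by (auto simp: bij_betw_def)
    then show ?thesis
      using bij inv by (simp add: pmf_map_inj bij_betw_def)
  next
    case False
    then have "y \<notin> set_pmf (map_pmf f M)"
      using bij by (simp add: bij_betw_def)
    with False show ?thesis by (simp only: set_pmf_iff not_not)
  qed
qed

section \<open>I.i.d. evaluation times listed in the order of selection\<close>

lemma eval_law_iid: "I \<in> iid_instances \<Longrightarrow> j \<in> opts I \<Longrightarrow> eval_law I j = eval_law I 1"
proof -
  assume "I \<in> iid_instances" "j \<in> opts I"
  moreover from this have "1 \<in> opts I" by (auto simp: opts_def)
  ultimately show ?thesis unfolding iid_instances_def by blast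
qed

text \<open>Intersecting with \<open>{1..horizon I}\<close> makes the alphabet finite also when
  there are no options, in which case nothing is assumed about \<open>eval_law I 1\<close>.\<close>

lemma set_evaluation_law:
  assumes "I \<in> iid_instances"
  shows "set_pmf (Pi_pmf (opts I) 0 (eval_law I)) =
    PiE_dflt (opts I) 0 (\<lambda>_. set_pmf (eval_law I 1) \<inter> {1..horizon I})"
proof -
  have "set_pmf (eval_law I j) \<subseteq> {1..horizon I}" if "j \<in> opts I" for j
  proof -
    from assms that have "set_pmf (eval_law I j) \<subseteq> {1..}" "eval_surv I j (horizon I) = 0"
      unfolding iid_instances_def sse_instance_def by blast+
    moreover from this(2) have "set_pmf (eval_law I j) \<inter> {horizon I<..} = {}"
      by (simp add: eval_surv_def measure_pmf_zero_iff)
    ultimately show ?thesis by fastforce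
  qed
  then have "set_pmf (eval_law I j) = set_pmf (eval_law I 1) \<inter> {1..horizon I}" if "j \<in> opts I" for j
    using eval_law_iid[OF assms that] that by (metis inf.absorb1)
  then show ?thesis
    by (simp add: set_Pi_pmf PiE_dflt_def)
qed

text \<open>Injectivity is the decoding of the list; surjectivity follows by counting, since both
  sides have \<open>card ?X ^ card (opts I)\<close> elements for the common finite alphabet
  \<open>?X\<close>.\<close>

lemma bij_revealed:
  assumes I: "I \<in> iid_instances" and p: "valid_policy p"
  shows "bij_betw (\<lambda>s. map s (ordering I p s e)) (set_pmf (Pi_pmf (opts I) 0 (eval_law I)))
    {u. set u \<subseteq> set_pmf (eval_law I 1) \<inter> {1..horizon I} \<and> length u = card (opts I)}"
    (is "bij_betw ?R ?A ?U")
proof -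
  let ?X = "set_pmf (eval_law I 1) \<inter> {1..horizon I}"
  note A = set_evaluation_law[OF I]
  have inj: "inj_on ?R ?A"
    by (rule inj_onI) (rule ordering_reveals_outcome[OF p], auto simp: A PiE_dflt_def)
  have "length (ordering I p s e) = card (opts I)" for s
    using distinct_ordering[OF p] by (metis distinct_card)
  then have "?R ` ?A \<subseteq> ?U"
    using distinct_ordering(2)[OF p] by (auto simp: A PiE_dflt_def)
  moreover have "card (?R ` ?A) = card ?U"
  proof -
    have "card (?R ` ?A) = card ?A"
      by (rule card_image[OF inj])
    also have "\<dots> = card ?X ^ card (opts I)"
      by (simp add: A card_PiE_dflt)
    also have "\<dots> = card ?U"
      by (rule card_lists_length_eq[symmetric]) simp
    finally show ?thesis .
  qed
  moreover have "finite ?U"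
    by (rule finite_lists_length_eq) simp
  ultimately have "?R ` ?A = ?U"
    by (intro card_subset_eq)
  with inj show ?thesis by (simp add: bij_betw_def)
qed

text \<open>Under a common law the weight of \<open>s\<close> depends only on the revealed list, so
  outcomes with equal lists under two policies have equal weight.\<close>

lemma pmf_evaluation_law:
  assumes "I \<in> iid_instances" "valid_policy p" "s \<in> set_pmf (Pi_pmf (opts I) 0 (eval_law I))"
  shows "pmf (Pi_pmf (opts I) 0 (eval_law I)) s =
    prod_list (map (pmf (eval_law I 1)) (map s (ordering I p s e)))"
proof -
  have "pmf (Pi_pmf (opts I) 0 (eval_law I)) s = (\<Prod>j\<in>opts I. pmf (eval_law I j) (s j))"
    using assms(3) by (intro pmf_Pi') (auto simp: set_evaluation_law[OF assms(1)] PiE_dflt_def)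
  also have "\<dots> = (\<Prod>j\<in>set (ordering I p s e). pmf (eval_law I 1) (s j))"
    using distinct_ordering(2)[OF assms(2)] eval_law_iid[OF assms(1)] by simp
  finally show ?thesis
    using distinct_ordering(1)[OF assms(2)] by (simp add: prod.distinct_set_conv_list comp_def)
qed

section \<open>Comparison of expectations\<close>

lemma total_worth_bounds:
  assumes "sse_instance I" "valid_policy p"
  shows "0 \<le> total_worth I p s e" "total_worth I p s e \<le> sum (worth I) (opts I)"
proof -
  have pos: "0 \<le> worth I j" if "j \<in> opts I" for j
    using assms(1) that by (auto simp: sse_instance_def intro: less_imp_le)
  note P = distinct_picks[OF assms(2), of I s e "last_expiry I e"]
  show "0 \<le> total_worth I p s e"
    unfolding total_worth_eq[OF assms(2)] using P pos by (intro sum_nonneg) auto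
  show "total_worth I p s e \<le> sum (worth I) (opts I)"
    unfolding total_worth_eq[OF assms(2)] using P pos by (intro sum_mono2) auto
qed

lemma greedy_half_expectation:
  assumes I: "I \<in> iid_instances" and p: "valid_policy p"
  shows "measure_pmf.expectation (outcome_law I) (\<lambda>(s, e). total_worth I p s e) \<le>
    2 * measure_pmf.expectation (outcome_law I) (\<lambda>(s, e). total_worth I (greedy I) s e)"
proof -
  define A where "A = set_pmf (Pi_pmf (opts I) 0 (eval_law I))"
  define R where "R q e s = map s (ordering I q s e)" for q e s
  \<comment> \<open>\<open>\<sigma> e s\<close> is the outcome on which greedy reveals the same list
    as \<open>p\<close> does on \<open>s\<close>, both with expiration times
    \<open>e\<close>.\<close>
  define \<sigma> where "\<sigma> e = inv_into A (R (greedy I) e) \<circ> R p e" for e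
  define \<Phi> where "\<Phi> = (\<lambda>(s, e). (\<sigma> e s, e))"
  have bij: "bij_betw (R q e) A
      {u. set u \<subseteq> set_pmf (eval_law I 1) \<inter> {1..horizon I} \<and> length u = card (opts I)}"
    if "valid_policy q" for q e
    using bij_revealed[OF I that, of e] by (simp add: A_def R_def[abs_def])
  have bij_\<sigma>: "bij_betw (\<sigma> e) A A" for e
    unfolding \<sigma>_def
    by (rule bij_betw_trans[OF bij[OF p] bij_betw_inv_into[OF bij[OF valid_greedy]]])
  have R_\<sigma>: "R (greedy I) e (\<sigma> e s) = R p e s" if "s \<in> A" for s e
  proof -
    have "R p e s \<in> R (greedy I) e ` A"
      using bij_betw_apply[OF bij[OF p] that]
      by (simp only: bij_betw_imp_surj_on[OF bij[OF valid_greedy]])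
    then show ?thesis by (simp add: \<sigma>_def f_inv_into_f)
  qed
  have \<sigma>_A: "\<sigma> e s \<in> A" if "s \<in> A" for s e
    using bij_\<sigma>[of e] that by (auto simp: bij_betw_def)
  have support: "set_pmf (outcome_law I) = A \<times> set_pmf (Pi_pmf (opts I) 0 (expir_law I))"
    by (simp add: outcome_law_def A_def)
  \<comment> \<open>For each fixed \<open>e\<close>, \<open>\<sigma> e\<close> permutes the
    evaluation outcomes and preserves their weights. Evaluation and expiration times are
    independent, so this passes to the joint law.\<close>
  have law: "map_pmf \<Phi> (outcome_law I) = outcome_law I"
  proof (rule map_pmf_bij_invariant)
    show "bij_betw \<Phi> (set_pmf (outcome_law I)) (set_pmf (outcome_law I))"
    proof (rule bij_betwI')
      fix x y assume "x \<in> set_pmf (outcome_law I)" "y \<in> set_pmf (outcome_law I)"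
      then show "\<Phi> x = \<Phi> y \<longleftrightarrow> x = y"
        using bij_\<sigma> by (auto simp: support \<Phi>_def bij_betw_def inj_on_def)
    next
      fix x assume "x \<in> set_pmf (outcome_law I)"
      then show "\<Phi> x \<in> set_pmf (outcome_law I)"
        using \<sigma>_A by (auto simp: support \<Phi>_def)
    next
      fix y assume y: "y \<in> set_pmf (outcome_law I)"
      then have "fst y \<in> \<sigma> (snd y) ` A"
        using bij_betw_imp_surj_on[OF bij_\<sigma>] by (auto simp: support)
      then obtain s where "s \<in> A" "\<sigma> (snd y) s = fst y" by force
      with y show "\<exists>x\<in>set_pmf (outcome_law I). y = \<Phi> x"
        by (intro bexI[of _ "(s, snd y)"]) (auto simp: support \<Phi>_def)
    qed
  next
    fix x assume x: "x \<in> set_pmf (outcome_law I)"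
    obtain s e where [simp]: "x = (s, e)" by force
    have s: "s \<in> A" using x by (simp add: support)
    then show "pmf (outcome_law I) (\<Phi> x) = pmf (outcome_law I) x"
      using pmf_evaluation_law[OF I p, of s e]
        pmf_evaluation_law[OF I valid_greedy[of I], of "\<sigma> e s" e] R_\<sigma>[OF s, of e] \<sigma>_A[OF s, of e]
      by (simp add: outcome_law_def pmf_pair \<Phi>_def A_def R_def del: map_map)
  qed
  let ?W = "\<lambda>q (s, e). total_worth I q s e"
  have sse: "sse_instance I" using I by (simp add: iid_instances_def)
  have integrable: "integrable (measure_pmf (outcome_law I)) (?W q)" if "valid_policy q" for q
    using total_worth_bounds[OF sse that]
    by (intro measure_pmf.integrable_const_bound[where B = "sum (worth I) (opts I)"]) auto
  have "measure_pmf.expectation (outcome_law I) (?W p) \<le>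
      measure_pmf.expectation (outcome_law I) (\<lambda>x. 2 * ?W (greedy I) (\<Phi> x))"
  proof (rule integral_mono_AE)
    \<comment> \<open>Integrability under the image law is integrability of the composition with
      \<open>\<Phi>\<close>.\<close>
    have "integrable (measure_pmf (map_pmf \<Phi> (outcome_law I))) (?W (greedy I))"
      unfolding law by (rule integrable[OF valid_greedy])
    then show "integrable (measure_pmf (outcome_law I)) (\<lambda>x. 2 * ?W (greedy I) (\<Phi> x))"
      by simp
    have "total_worth I p s e \<le> 2 * total_worth I (greedy I) (\<sigma> e s) e" if s: "s \<in> A" for s e
    proof (rule greedy_half_pathwise[OF p])
      show "0 < worth I j" if "j \<in> opts I" for j
        using sse that by (simp add: sse_instance_def)
      show "1 \<le> \<sigma> e s j" if "j \<in> opts I" for j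
        using \<sigma>_A[OF s, of e] that by (simp add: A_def set_evaluation_law[OF I] PiE_dflt_def)
      show "map s (ordering I p s e) = map (\<sigma> e s) (ordering I (greedy I) (\<sigma> e s) e)"
        using R_\<sigma>[OF s, of e] by (simp add: R_def)
    qed
    then show "AE x in measure_pmf (outcome_law I). ?W p x \<le> 2 * ?W (greedy I) (\<Phi> x)"
      by (auto simp: AE_measure_pmf_iff support \<Phi>_def)
  qed (rule integrable[OF p])
  also have "\<dots> = 2 * measure_pmf.expectation (map_pmf \<Phi> (outcome_law I)) (?W (greedy I))"
    by simp
  finally show ?thesis by (simp add: law)
qed

section \<open>Randomized policies and the online optimum\<close>

lemma prob_space_seed: "prob_space seed_measure"
  unfolding seed_measure_def
  by (intro prob_space_PiM prob_space_uniform_measure) auto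

lemma opt_worth_le:
  assumes I: "I \<in> iid_instances"
  shows "opt_worth I \<le> 2 * expected_worth I (\<lambda>_. greedy I)"
proof -
  interpret prob_space seed_measure by (rule prob_space_seed)
  define G where
    "G = measure_pmf.expectation (outcome_law I) (\<lambda>(s, e). total_worth I (greedy I) s e)"
  have G: "0 \<le> G"
    using I total_worth_bounds(1)[OF _ valid_greedy]
    by (auto simp: G_def iid_instances_def intro!: integral_nonneg_AE)
  have "expected_worth I (\<lambda>_. greedy I) = G"
    by (simp add: expected_worth_def G_def prob_space)
  moreover have "expected_worth I \<pi> \<le> 2 * G" if "online_policy \<pi>" for \<pi>
  proof -
    let ?f = "\<lambda>\<omega>. measure_pmf.expectation (outcome_law I) (\<lambda>(s, e). total_worth I (\<pi> \<omega>) s e)"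
    have "?f \<omega> \<le> 2 * G" for \<omega>
      unfolding G_def using that
      by (intro greedy_half_expectation[OF I]) (auto simp: online_policy_def valid_policy_def)
    \<comment> \<open>The bound holds seed by seed and survives averaging. If the integrand is not
      integrable, the integral is 0 by convention, and \<open>0 \<le> G\<close> settles that
      case.\<close>
    then show ?thesis
      unfolding expected_worth_def
      by (cases "integrable seed_measure ?f")
        (use G in \<open>auto simp: not_integrable_integral_eq intro: integral_le_const\<close>)
  qed
  \<comment> \<open>A witness that the supremum is taken over a nonempty set, as bounding a real
    supremum from above requires.\<close>
  moreover have "online_policy (\<lambda>_ _ _. None)"
    by (simp add: online_policy_def)
  ultimately show ?thesis
    unfolding opt_worth_def by (intro cSUP_least) auto
qed


section \<open>The greedy program\<close>

text \<open>Address 0 holds the scan index; address 1 holds the best option so far, with 0 for none.\<close>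

definition scan_loop :: prog where
  "scan_loop = While (ILess (Lit 0) (IMem (Lit 0)))
     (Seq
       (Branch
         (Conj (IsAvailable (IMem (Lit 0)))
           (Neg (Conj (ILess (Lit 0) (IMem (Lit 1)))
             (RLess (Worth (IMem (Lit 0))) (Worth (IMem (Lit 1)))))))
         (IAssign (Lit 1) (IMem (Lit 0)))
         Skip)
       (IAssign (Lit 0) (Minus (IMem (Lit 0)) (Lit 1))))"

definition scan_prog :: prog where
  "scan_prog = Seq (IAssign (Lit 0) NumOpts) (Seq (IAssign (Lit 1) (Lit 0)) scan_loop)"

text \<open>The loop ends at the first unsuccessful scan instead of waiting, because nothing can
  become available later. \<open>Select\<close> moves the clock directly to the next decision
  time.\<close>

definition greedy_loop :: prog where
  "greedy_loop = While (ILess (Lit 0) (IMem (Lit 1))) (Seq (Select (IMem (Lit 1))) scan_prog)"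

definition greedy_prog :: prog where
  "greedy_prog = Seq scan_prog greedy_loop"

section \<open>Execution of the scan\<close>

lemma available_now_imem [simp]: "available_now I e (\<sigma>\<lparr>imem := m\<rparr>) = available_now I e \<sigma>"
  by (simp add: available_now_def)

text \<open>A round takes four steps: the loop test, the branch test, one command in either branch,
  and the decrement. The failing last test adds one. Only \<open>imem\<close> changes, so the
  available set is the same throughout.\<close>

lemma exec_scan_loop:
  assumes "imem \<sigma> 0 = i" "imem \<sigma> 1 = b"
  shows "\<exists>m. exec I \<omega> s e scan_loop \<sigma> (4 * i + 1) (\<sigma>\<lparr>imem := m\<rparr>) \<and>
    m 1 = scan I (available_now I e \<sigma>) b i"
  using assms
proof (induction i arbitrary: \<sigma> b)
  case 0
  then have "exec I \<omega> s e scan_loop \<sigma> 1 \<sigma>"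
    unfolding scan_loop_def by (intro exec.WhileFalse) simp
  with 0 show ?case by (intro exI[of _ "imem \<sigma>"]) simp
next
  case (Suc i)
  let ?A = "available_now I e \<sigma>"
  define b' where
    "b' = (if Suc i \<in> ?A \<and> \<not> (0 < b \<and> worth I (Suc i) < worth I b) then Suc i else b)"
  define \<sigma>' where "\<sigma>' = \<sigma>\<lparr>imem := (imem \<sigma>)(1 := b')\<rparr>"
  define \<sigma>'' where "\<sigma>'' = \<sigma>\<lparr>imem := (imem \<sigma>)(1 := b', 0 := i)\<rparr>"
  let ?t = "Conj (IsAvailable (IMem (Lit 0))) (Neg (Conj (ILess (Lit 0) (IMem (Lit 1)))
    (RLess (Worth (IMem (Lit 0))) (Worth (IMem (Lit 1))))))"
  have "exec I \<omega> s e (Branch ?t (IAssign (Lit 1) (IMem (Lit 0))) Skip) \<sigma> (Suc 1) \<sigma>'"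
  proof (cases "holds I e \<sigma> ?t")
    case True
    then have "\<sigma>' = \<sigma>\<lparr>imem := (imem \<sigma>)(ieval I \<sigma> (Lit 1) := ieval I \<sigma> (IMem (Lit 0)))\<rparr>"
      using Suc.prems by (auto simp: \<sigma>'_def b'_def)
    then show ?thesis by (simp only:) (intro exec.BranchTrue exec.IAssign True)
  next
    case False
    then have "\<sigma>' = \<sigma>"
      using Suc.prems by (auto simp: \<sigma>'_def b'_def fun_upd_idem)
    then show ?thesis by (simp only:) (intro exec.BranchFalse exec.Skip False)
  qed
  moreover have "exec I \<omega> s e (IAssign (Lit 0) (Minus (IMem (Lit 0)) (Lit 1))) \<sigma>' 1 \<sigma>''"
    using exec.IAssign[of I \<omega> s e "Lit 0" "Minus (IMem (Lit 0)) (Lit 1)" \<sigma>'] Suc.prems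
    by (simp add: \<sigma>'_def \<sigma>''_def)
  moreover obtain m where "exec I \<omega> s e scan_loop \<sigma>'' (4 * i + 1) (\<sigma>''\<lparr>imem := m\<rparr>)"
      and m: "m 1 = scan I ?A b' i"
    using Suc.IH[of \<sigma>'' b'] by (auto simp: \<sigma>''_def)
  ultimately have exec: "exec I \<omega> s e scan_loop \<sigma> (Suc ((Suc 1 + 1) + (4 * i + 1))) (\<sigma>''\<lparr>imem := m\<rparr>)"
    using Suc.prems unfolding scan_loop_def
    by (intro exec.WhileTrue[where \<sigma>' = \<sigma>''] exec.Seq[where \<sigma>' = \<sigma>']) auto
  have "Suc ((Suc 1 + 1) + (4 * i + 1)) = 4 * Suc i + 1" by simp
  moreover have "\<sigma>''\<lparr>imem := m\<rparr> = \<sigma>\<lparr>imem := m\<rparr>" by (simp add: \<sigma>''_def)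
  ultimately have "exec I \<omega> s e scan_loop \<sigma> (4 * Suc i + 1) (\<sigma>\<lparr>imem := m\<rparr>)"
    using exec by (simp only:)
  with m show ?case by (intro exI[of _ m] conjI) (simp_all add: b'_def)
qed

lemma exec_scan_prog:
  "\<exists>m. exec I \<omega> s e scan_prog \<sigma> (4 * num_opts I + 3) (\<sigma>\<lparr>imem := m\<rparr>) \<and>
    m 1 = scan I (available_now I e \<sigma>) 0 (num_opts I)"
proof -
  define \<sigma>' where "\<sigma>' = \<sigma>\<lparr>imem := (imem \<sigma>)(0 := num_opts I)\<rparr>"
  define \<sigma>'' where "\<sigma>'' = \<sigma>\<lparr>imem := (imem \<sigma>)(0 := num_opts I, 1 := 0)\<rparr>"
  obtain m where m: "exec I \<omega> s e scan_loop \<sigma>'' (4 * num_opts I + 1) (\<sigma>''\<lparr>imem := m\<rparr>)"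
      "m 1 = scan I (available_now I e \<sigma>) 0 (num_opts I)"
    using exec_scan_loop[of \<sigma>'' "num_opts I" 0 I \<omega> s e] by (auto simp: \<sigma>''_def)
  have "exec I \<omega> s e (IAssign (Lit 0) NumOpts) \<sigma> 1 \<sigma>'"
    using exec.IAssign[of I \<omega> s e "Lit 0" NumOpts \<sigma>] by (simp add: \<sigma>'_def)
  moreover have "exec I \<omega> s e (IAssign (Lit 1) (Lit 0)) \<sigma>' 1 \<sigma>''"
    using exec.IAssign[of I \<omega> s e "Lit 1" "Lit 0" \<sigma>'] by (simp add: \<sigma>'_def \<sigma>''_def)
  ultimately have exec: "exec I \<omega> s e scan_prog \<sigma> (1 + (1 + (4 * num_opts I + 1))) (\<sigma>''\<lparr>imem := m\<rparr>)"
    using m unfolding scan_prog_def by (intro exec.Seq)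
  have "1 + (1 + (4 * num_opts I + 1)) = 4 * num_opts I + 3" by simp
  moreover have "\<sigma>''\<lparr>imem := m\<rparr> = \<sigma>\<lparr>imem := m\<rparr>" by (simp add: \<sigma>''_def)
  ultimately have "exec I \<omega> s e scan_prog \<sigma> (4 * num_opts I + 3) (\<sigma>\<lparr>imem := m\<rparr>)"
    using exec by (simp only:)
  with m(2) show ?thesis by blast
qed

section \<open>Simulation of the greedy policy and its running time\<close>

lemma busy_run:
  "k \<le> l \<Longrightarrow> l < free_time I p s e k \<Longrightarrow>
    selection_list I p s e l = selection_list I p s e k \<and> free_time I p s e l = free_time I p s e k"
proof (induction l rule: dec_induct)
  case (step l)
  then show ?case
    by (cases rule: trajectory_cases[of l I p s e]) (auto simp del: selection_list.simps)
qed simp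

text \<open>The premises are the loop invariant: the trajectory is known up to time
  \<open>k\<close>, and the clock \<open>Suc k\<close> is the next decision time. Each round removes
  one unselected option and takes \<open>4 * num_opts I + 5\<close> steps: the loop test, the
  selection and a scan of \<open>4 * num_opts I + 3\<close> steps.\<close>

lemma exec_greedy_loop:
  assumes s: "\<And>j. j \<in> opts I \<Longrightarrow> 1 \<le> s j"
    and "clock \<sigma> = Suc k" "free_time I (greedy I) s e k = Suc k"
    and "sel_log \<sigma> = selection_list I (greedy I) s e k"
    and "imem \<sigma> 1 = scan I (available_now I e \<sigma>) 0 (num_opts I)"
  shows "\<exists>r \<tau>. exec I \<omega> s e greedy_loop \<sigma> r \<tau> \<and>
    r \<le> card (opts I - set (picks I (greedy I) s e k)) * (4 * num_opts I + 5) + 1 \<and>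
    set (sel_log \<tau>) = selections I (greedy I) s e"
  using assms(2-)
proof (induction "card (opts I - set (picks I (greedy I) s e k))" arbitrary: \<sigma> k rule: less_induct)
  case less
  let ?P = "\<lambda>k. set (picks I (greedy I) s e k)"
  let ?A = "available I e (Suc k) (?P k)"
  define b where "b = scan I ?A 0 (num_opts I)"
  have A: "available_now I e \<sigma> = ?A"
    using less.prems by (simp add: available_now_def picks_def)
  then have b: "imem \<sigma> 1 = b" using less.prems by (simp add: b_def)
  define h where "h = fst (trajectory I (greedy I) s e k)"
  show ?case
  proof (cases "b = 0")
    case True
    then have "greedy I h ?A = None" by (simp add: greedy_def b_def)
    then have "e j \<le> Suc k" if "j \<in> opts I" "j \<notin> ?P k" for j
      using greedy_None[OF \<open>greedy I h ?A = None\<close> that(1)] that by (simp add: available_def)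
    then have "selections I (greedy I) s e = set (selection_list I (greedy I) s e k)"
      by (rule selections_stable[OF valid_greedy])
    moreover have "exec I \<omega> s e greedy_loop \<sigma> 1 \<sigma>"
      unfolding greedy_loop_def using b True by (intro exec.WhileFalse) simp
    ultimately show ?thesis
      using less.prems by (intro exI[of _ 1] exI[of _ \<sigma>]) simp
  next
    case False
    then have g: "greedy I h ?A = Some b" by (simp add: greedy_def b_def)
    then have bA: "b \<in> ?A" using valid_greedy by (auto simp: valid_policy_def)
    then have b1: "1 \<le> s b" using s by (simp add: available_def)
    \<comment> \<open>The evaluation of \<open>b\<close> occupies the times \<open>Suc k\<close> to
      \<open>k'\<close>, so the next decision falls at \<open>Suc k'\<close>.\<close>
    define k' where "k' = k + s b"
    have next1: "selection_list I (greedy I) s e (Suc k) = selection_list I (greedy I) s e k @ [(Suc k, b)]"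
      "free_time I (greedy I) s e (Suc k) = Suc k'"
      using g less.prems(2)
      by (cases rule: trajectory_cases[of k I "greedy I" s e];
          simp add: h_def k'_def del: selection_list.simps)+
    \<comment> \<open>The program's clock jumps over an evaluation in one step, while the trajectory
      passes through it unit by unit. \<open>1 \<le> s b\<close> gives
      \<open>Suc k \<le> k'\<close>.\<close>
    then have next2: "selection_list I (greedy I) s e k' = selection_list I (greedy I) s e k @ [(Suc k, b)]"
      "free_time I (greedy I) s e k' = Suc k'"
      using busy_run[of "Suc k" k' I "greedy I" s e] b1 by (auto simp: k'_def)
    define \<sigma>' where "\<sigma>' = \<sigma>\<lparr>clock := clock \<sigma> + s b, sel_log := sel_log \<sigma> @ [(clock \<sigma>, b)]\<rparr>"
    obtain m where m: "exec I \<omega> s e scan_prog \<sigma>' (4 * num_opts I + 3) (\<sigma>'\<lparr>imem := m\<rparr>)"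
        "m 1 = scan I (available_now I e \<sigma>') 0 (num_opts I)"
      using exec_scan_prog by blast
    have "?P k' = insert b (?P k)"
      using next2 by (simp add: picks_def)
    then have "opts I - ?P k' = (opts I - ?P k) - {b}" by blast
    moreover have "b \<in> opts I - ?P k" using bA by (simp add: available_def)
    ultimately have card: "card (opts I - ?P k) = Suc (card (opts I - ?P k'))"
      by (simp only: card_Suc_Diff1 finite_Diff finite_opts)
    have "\<exists>r \<tau>. exec I \<omega> s e greedy_loop (\<sigma>'\<lparr>imem := m\<rparr>) r \<tau> \<and>
        r \<le> card (opts I - ?P k') * (4 * num_opts I + 5) + 1 \<and>
        set (sel_log \<tau>) = selections I (greedy I) s e"
      by (rule less.hyps) (use card next2 m(2) less.prems in \<open>simp_all add: \<sigma>'_def k'_def\<close>)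
    then obtain r \<tau> where r: "exec I \<omega> s e greedy_loop (\<sigma>'\<lparr>imem := m\<rparr>) r \<tau>"
        "r \<le> card (opts I - ?P k') * (4 * num_opts I + 5) + 1"
        "set (sel_log \<tau>) = selections I (greedy I) s e"
      by blast
    have "exec I \<omega> s e (Select (IMem (Lit 1))) \<sigma> 1 \<sigma>'"
      unfolding \<sigma>'_def using b bA A by (intro exec.Select) auto
    then have "exec I \<omega> s e (Seq (Select (IMem (Lit 1))) scan_prog) \<sigma>
        (1 + (4 * num_opts I + 3)) (\<sigma>'\<lparr>imem := m\<rparr>)"
      using m(1) by (rule exec.Seq)
    then have "exec I \<omega> s e greedy_loop \<sigma> (Suc ((1 + (4 * num_opts I + 3)) + r)) \<tau>"
      using b False r(1) unfolding greedy_loop_def by (intro exec.WhileTrue) auto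
    with r card show ?thesis
      by (intro exI[of _ "Suc ((1 + (4 * num_opts I + 3)) + r)"] exI[of _ \<tau>]) simp
  qed
qed

lemma exec_greedy_prog:
  assumes "I \<in> iid_instances" "possible I \<omega> s e"
  shows "\<exists>r \<tau>. exec I \<omega> s e greedy_prog init_state r \<tau> \<and>
    r \<le> 9 * (num_opts I + horizon I + 1) ^ 2 \<and> set (sel_log \<tau>) = selections I (greedy I) s e"
proof -
  let ?n = "num_opts I"
  have s: "1 \<le> s j" if "j \<in> opts I" for j
    using assms that
    by (simp add: possible_def outcome_law_def set_evaluation_law PiE_dflt_def)
  obtain m where m: "exec I \<omega> s e scan_prog init_state (4 * ?n + 3) (init_state\<lparr>imem := m\<rparr>)"
      "m 1 = scan I (available_now I e init_state) 0 ?n"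
    using exec_scan_prog by blast
  obtain r \<tau> where r: "exec I \<omega> s e greedy_loop (init_state\<lparr>imem := m\<rparr>) r \<tau>"
      "r \<le> card (opts I - set (picks I (greedy I) s e 0)) * (4 * ?n + 5) + 1"
      "set (sel_log \<tau>) = selections I (greedy I) s e"
    using exec_greedy_loop[of I s "init_state\<lparr>imem := m\<rparr>" 0 e \<omega>] s m(2)
    by (auto simp: init_state_def free_time_def available_now_def)
  have "exec I \<omega> s e greedy_prog init_state ((4 * ?n + 3) + r) \<tau>"
    unfolding greedy_prog_def using m(1) r(1) by (rule exec.Seq)
  moreover have "(4 * ?n + 3) + r \<le> 9 * (?n + horizon I + 1) ^ 2"
  proof -
    \<comment> \<open>The first scan and at most \<open>?n\<close> rounds give \<open>(4 * ?n + 3) +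
      ?n * (4 * ?n + 5) + 1 = 4 * ?n ^ 2 + 9 * ?n + 4\<close>.\<close>
    have "(4 * ?n + 3) + r \<le> 9 * (?n + 1) ^ 2"
      using r(2) by (simp add: picks_def opts_def power2_eq_square algebra_simps)
    also have "\<dots> \<le> 9 * (?n + horizon I + 1) ^ 2"
      by (intro mult_left_mono power_mono) auto
    finally show ?thesis .
  qed
  ultimately show ?thesis using r(3) by blast
qed

theorem theorem1p2:
  shows "\<exists>c. polynomial_time c iid_instances \<and>
    (\<forall>I\<in>iid_instances. \<exists>\<pi>. online_policy \<pi> \<and> implements I c \<pi> \<and>
       expected_worth I \<pi> \<ge> 1 / 2 * opt_worth I)"
proof (intro exI conjI ballI)
  show "polynomial_time greedy_prog iid_instances"
    unfolding polynomial_time_def using exec_greedy_prog by blast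
  fix I assume I: "I \<in> iid_instances"
  show "online_policy (\<lambda>_. greedy I)"
    using valid_greedy by (auto simp: online_policy_def valid_policy_def)
  show "implements I greedy_prog (\<lambda>_. greedy I)"
    unfolding implements_def using exec_greedy_prog[OF I] by blast
  show "expected_worth I (\<lambda>_. greedy I) \<ge> 1 / 2 * opt_worth I"
    using opt_worth_le[OF I] by simp
qed

end
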